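(* Let $f:\mathbb{N}\to\mathbb{R}\setminus\{0\}$ be a multiplicative function such that $$\sum_{p\ \text{prime}:\ |f(p)|\neq 1}\frac1p<\infty .$$ Then there is a $u\in\{-1,+1\}$ such that $$\limsup_{x\to\infty}\frac{1}{\log x}\sum_{n\le x}\frac{1_{f(n)=uf(n+2)}}{n}>0 .$$
   Context: $\mathbb{N}$ denotes the positive integers. A function $f$ on $\mathbb{N}$ is multiplicative if $f(1)=1$ and $f(mn)=f(m)f(n)$ whenever $\gcd(m,n)=1$. $1_P$ equals $1$ if $P$ holds and $0$ otherwise. *)

theory Defs
  imports "HOL-Analysis.Analysis" "HOL-Computational_Algebra.Primes"
begin

(* Arithmetic functions live on the positive integers; the value at 0 is a junk value and is
   left unconstrained. *)
definition multiplicative :: "(nat \<Rightarrow> real) \<Rightarrow> bool" where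
  "multiplicative f \<longleftrightarrow>
     f 1 = 1 \<and> (\<forall>m n. m > 0 \<longrightarrow> n > 0 \<longrightarrow> coprime m n \<longrightarrow> f (m * n) = f m * f n)"

end

theory Submission
  imports Defs "HOL-Number_Theory.Cong"
begin

text \<open>
  It suffices that \<open>\<bar>f n\<bar> = \<bar>f (n + 2)\<bar>\<close> for a set of \<open>n\<close> of positive lower logarithmic density,
  since then one of the two signs \<open>u\<close> works. Both values are \<open>1\<close> as soon as neither \<open>n\<close> nor
  \<open>n + 2\<close> is divisible by a prime with \<open>\<bar>f p\<bar> \<noteq> 1\<close> or by the square of a prime. These forbidden
  divisors \<open>q\<close> satisfy \<open>\<Sum> 1/q < \<infinity>\<close>. Choose \<open>M\<close> divisible by all of them but a set \<open>Q\<close> with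
  \<open>\<Sum>q\<in>Q. 1/q \<le> 1/8\<close>. If \<open>n \<equiv> -1 (mod M)\<close>, then \<open>n\<close> and \<open>n + 2\<close> are coprime to \<open>M\<close>, so only
  divisors \<open>q \<in> Q\<close> coprime to \<open>M\<close> matter, and each of these removes a proportion \<open>O(1/q)\<close> of the
  progression.
\<close>

section \<open>Tails of nonnegative summable families\<close>

lemma summable_on_small_tail:
  fixes g :: "'a \<Rightarrow> real"
  assumes "g summable_on A" and nonneg: "\<And>x. x \<in> A \<Longrightarrow> g x \<ge> 0" and "\<epsilon> > 0"
  obtains F where "finite F" "F \<subseteq> A" "\<And>G. finite G \<Longrightarrow> G \<subseteq> A - F \<Longrightarrow> sum g G \<le> \<epsilon>"
proof -
  from assms(1) obtain s where s: "(g has_sum s) A"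
    by (auto simp: summable_on_def)
  from has_sum_finite_approximation[OF s \<open>\<epsilon> > 0\<close>] obtain F
    where F: "finite F" "F \<subseteq> A" "dist (sum g F) s \<le> \<epsilon>"
    by blast
  have "sum g G \<le> \<epsilon>" if G: "finite G" "G \<subseteq> A - F" for G
  proof -
    have "sum g (F \<union> G) \<le> s"
      by (rule finite_sum_le_has_sum[OF s]) (use F G nonneg in auto)
    moreover have "sum g (F \<union> G) = sum g F + sum g G"
      by (rule sum.union_disjoint) (use F G in auto)
    ultimately show ?thesis
      using F(3) by (auto simp: dist_real_def)
  qed
  with F show ?thesis
    using that by blast
qed

section \<open>Logarithmic sums over one residue class\<close>

lemma harm_le_1_plus_ln: "n > 0 \<Longrightarrow> harm n \<le> 1 + ln (real n)"
  using euler_mascheroni_sequence_decreasing[of 1 n] by (simp add: harm_def)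

text \<open>Members of one class modulo \<open>M\<close> have distinct quotients
  \<open>j = n div M\<close>, and \<open>n \<ge> j * M\<close>. The quotient 0, taken at most once,
  costs at most 1; the others cost at most \<open>1 / (j * M)\<close> each.\<close>

lemma sum_inverse_residue_class_le:
  assumes "A \<subseteq> {1..N}" and "M > 0" and cong: "\<And>m n. m \<in> A \<Longrightarrow> n \<in> A \<Longrightarrow> [m = n] (mod M)"
  shows "(\<Sum>n\<in>A. 1 / real n) \<le> 1 + harm N / real M"
proof -
  define g where "g j = (if j = 0 then 1 else 1 / (real j * real M))" for j
  have inj: "inj_on (\<lambda>n. n div M) A"
    using cong by (auto intro!: inj_onI simp: cong_def) (metis div_mult_mod_eq)
  have le: "1 / real n \<le> g (n div M)" if "n \<in> A" for n
  proof -
    have "n \<ge> 1"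
      using that assms(1) by auto
    moreover have "1 / real n \<le> 1 / (real (n div M) * real M)" if "n div M > 0"
    proof (rule divide_left_mono)
      show "real (n div M) * real M \<le> real n"
        by (metis div_times_less_eq_dividend of_nat_le_iff of_nat_mult)
    qed (use that \<open>M > 0\<close> \<open>n \<ge> 1\<close> in auto)
    ultimately show ?thesis
      by (auto simp: g_def)
  qed
  have "(\<Sum>n\<in>A. 1 / real n) \<le> (\<Sum>n\<in>A. g (n div M))"
    by (rule sum_mono) (rule le)
  also have "\<dots> = sum g ((\<lambda>n. n div M) ` A)"
    by (simp add: sum.reindex[OF inj])
  also have "\<dots> \<le> sum g (insert 0 {1..N})"
    using assms(1) by (intro sum_mono2) (auto simp: g_def subset_iff intro: le_trans[OF div_le_dividend])
  also have "\<dots> = 1 + (\<Sum>j=1..N. 1 / (real j * real M))"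
    by (simp add: g_def)
  also have "(\<Sum>j=1..N. 1 / (real j * real M)) = harm N / real M"
    by (simp add: harm_def sum_divide_distrib field_simps)
  finally show ?thesis .
qed

text \<open>Dividing every element by \<open>q\<close> pulls out the factor \<open>1 / q\<close>. As
  \<open>q\<close> is invertible modulo \<open>M\<close>, the quotients still lie in a single class,
  so the previous bound applies to them.\<close>

lemma sum_inverse_multiples_residue_class_le:
  assumes "A \<subseteq> {1..N}" and "M > 0" and cong: "\<And>m n. m \<in> A \<Longrightarrow> n \<in> A \<Longrightarrow> [m = n] (mod M)"
    and "coprime q M" and dvd: "\<And>n. n \<in> A \<Longrightarrow> q dvd n"
  shows "(\<Sum>n\<in>A. 1 / real n) \<le> (1 + harm N / real M) / real q"
proof (cases "A = {}")
  case True
  then show ?thesis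
    by (simp add: harm_nonneg)
next
  case False
  define B where "B = (\<lambda>n. n div q) ` A"
  \<comment> \<open>The empty case is split off because it is a positive multiple of
    \<open>q\<close> in \<open>A\<close> that excludes \<open>q = 0\<close>.\<close>
  have "q > 0"
    using False dvd assms(1) by (metis all_not_in_conv atLeastAtMost_iff dvd_0_left_iff gr0I not_one_le_zero subsetD)
  have A: "A = (\<lambda>m. q * m) ` B"
    using dvd by (auto simp: B_def image_image intro!: image_eqI)
  have inj: "inj_on (\<lambda>m. q * m) B"
    using \<open>q > 0\<close> by (auto intro: inj_onI)
  have "(\<Sum>n\<in>A. 1 / real n) = (\<Sum>m\<in>B. 1 / real m) / real q"
    unfolding A by (subst sum.reindex[OF inj]) (simp add: sum_divide_distrib field_simps)
  also have "(\<Sum>m\<in>B. 1 / real m) \<le> 1 + harm N / real M"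
  proof (rule sum_inverse_residue_class_le[OF _ \<open>M > 0\<close>])
    show "B \<subseteq> {1..N}"
    proof
      fix m assume "m \<in> B"
      then have "q * m \<in> {1..N}"
        using A assms(1) by blast
      then show "m \<in> {1..N}"
        using \<open>q > 0\<close> by (cases m; cases q) auto
    qed
    show "[m = n] (mod M)" if "m \<in> B" "n \<in> B" for m n
      using cong[of "q * m" "q * n"] that A cong_mult_lcancel_nat[OF \<open>coprime q M\<close>] by blast
  qed
  finally show ?thesis
    using \<open>q > 0\<close> by (simp add: divide_right_mono)
qed

section \<open>Sieving the class of -1 modulo \<open>M\<close>\<close>

text \<open>Both numbers are neighbours of the multiple \<open>n + 1\<close> of \<open>M\<close>,
  and consecutive integers are coprime. This is why the class of -1 is used.\<close>

lemma coprime_if_dvd_Suc: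
  fixes M n :: nat
  assumes "M dvd n + 1"
  shows "coprime M n" "coprime M (n + 2)"
proof -
  have *: "coprime M k" if "coprime (n + 1) k" for k
    using that assms by (rule coprime_divisors[rotated 2]) auto
  show "coprime M n"
    by (rule *) simp
  show "coprime M (n + 2)"
    using * coprime_Suc_right_nat[of "n + 1"] by simp
qed

text \<open>Union bound over \<open>q\<close> and over the two events \<open>q dvd n\<close> and
  \<open>q dvd n + 2\<close>. With \<open>h = harm N / M\<close> they cost
  \<open>(1 + h) / q\<close> and \<open>3 * (2 + h) / q\<close>, which explains the constants 7 and
  4.\<close>

lemma sum_inverse_sieve_le:
  fixes M N :: nat and Q :: "nat set"
  assumes "M > 0" "N > 0" "finite Q"
    and cop: "\<And>q. q \<in> Q \<Longrightarrow> coprime q M"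
    and C: "C \<subseteq> {1..N}" "\<And>n. n \<in> C \<Longrightarrow> M dvd n + 1"
  shows "(\<Sum>n | n \<in> C \<and> (\<exists>q\<in>Q. q dvd n \<or> q dvd n + 2). 1 / real n)
           \<le> (7 + 4 * harm N / real M) * (\<Sum>q\<in>Q. 1 / real q)"
proof -
  have finC: "finite C"
    using C(1) finite_subset by blast
  have cong: "[m = n] (mod M)" if "m \<in> C" "n \<in> C" for m n
    using C(2)[OF that(1)] C(2)[OF that(2)]
    by (metis cong_0_iff cong_add_rcancel_nat cong_sym cong_trans)
  have b1: "(\<Sum>n | n \<in> C \<and> q dvd n. 1 / real n) \<le> (1 + harm N / M) / real q" if "q \<in> Q" for q
    by (rule sum_inverse_multiples_residue_class_le) (use C cong cop that \<open>M > 0\<close> in auto)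
  \<comment> \<open>The translation by 2 below enlarges the range to \<open>N + 2\<close>; the two
    extra terms add at most 1.\<close>
  have harm: "harm (N + 2) / real M \<le> harm N / real M + (1::real)"
  proof -
    have "harm (N + 2) = harm N + (1 / real (N + 1) + 1 / real (N + 2))"
      by (simp add: numeral_2_eq_2 harm_Suc inverse_eq_divide)
    also have "1 / real (N + 1) + 1 / real (N + 2) \<le> 1 / 2 + 1 / 2"
      using \<open>N > 0\<close> by (intro add_mono) (auto simp: field_simps)
    finally have "harm (N + 2) / real M \<le> (harm N + 1) / real M"
      using \<open>M > 0\<close> by (intro divide_right_mono) auto
    also have "\<dots> \<le> harm N / real M + 1"
      using \<open>M > 0\<close> by (simp add: field_simps)
    finally show ?thesis .
  qed
  have b2: "(\<Sum>n | n \<in> C \<and> q dvd n + 2. 1 / real n) \<le> 3 * (2 + harm N / M) / real q"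
    if "q \<in> Q" for q
  proof -
    define A where "A = {n \<in> C. q dvd n + 2}"
    \<comment> \<open>Translating by 2 turns the condition into divisibility of the summation
      variable itself. The price is the factor 3, attained at \<open>n = 1\<close>.\<close>
    have "(\<Sum>n\<in>A. 1 / real n) \<le> (\<Sum>n\<in>A. 3 * (1 / real (n + 2)))"
    proof (rule sum_mono)
      fix n assume "n \<in> A"
      then have "n \<ge> 1"
        using C(1) by (auto simp: A_def)
      then show "1 / real n \<le> 3 * (1 / real (n + 2))"
        by (simp add: field_simps)
    qed
    also have "\<dots> = 3 * (\<Sum>n\<in>(\<lambda>n. n + 2) ` A. 1 / real n)"
      by (subst sum.reindex) (auto simp: sum_distrib_left intro: inj_onI)
    also have "(\<Sum>n\<in>(\<lambda>n. n + 2) ` A. 1 / real n) \<le> (1 + harm (N + 2) / M) / real q"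
    proof (rule sum_inverse_multiples_residue_class_le)
      show "(\<lambda>n. n + 2) ` A \<subseteq> {1..N + 2}"
        using C(1) by (auto simp: A_def)
      show "[m = n] (mod M)" if "m \<in> (\<lambda>n. n + 2) ` A" "n \<in> (\<lambda>n. n + 2) ` A" for m n
        using that cong unfolding A_def by (auto simp only: cong_add_rcancel_nat)
    qed (use that cop \<open>M > 0\<close> in \<open>auto simp: A_def\<close>)
    also have "\<dots> \<le> (2 + harm N / M) / real q"
      using harm by (intro divide_right_mono) auto
    finally show ?thesis
      by (simp add: A_def)
  qed
  \<comment> \<open>Indicator weights put all sums over the same index set \<open>C\<close>, so that
    the order of summation can be exchanged.\<close>
  have sum_filter: "(\<Sum>n | n \<in> C \<and> P n. 1 / real n) = (\<Sum>n\<in>C. of_bool (P n) / real n)" for P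
    unfolding sum.inter_filter[OF finC] by (rule sum.cong) auto
  have "(\<Sum>n | n \<in> C \<and> (\<exists>q\<in>Q. q dvd n \<or> q dvd n + 2). 1 / real n)
      \<le> (\<Sum>n\<in>C. \<Sum>q\<in>Q. of_bool (q dvd n) / real n + of_bool (q dvd n + 2) / real n)"
    (is "sum _ ?B \<le> _")
  proof -
    have "sum (\<lambda>n. 1 / real n) ?B
        \<le> (\<Sum>n\<in>?B. \<Sum>q\<in>Q. of_bool (q dvd n) / real n + of_bool (q dvd n + 2) / real n)"
    proof (rule sum_mono)
      fix n assume "n \<in> ?B"
      then obtain q where q: "q \<in> Q" "q dvd n \<or> q dvd n + 2"
        by blast
      then have "1 / real n \<le> of_bool (q dvd n) / real n + of_bool (q dvd n + 2) / real n"
        by auto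
      also have "\<dots> \<le> (\<Sum>q\<in>Q. of_bool (q dvd n) / real n + of_bool (q dvd n + 2) / real n)"
        by (rule member_le_sum) (use q \<open>finite Q\<close> in auto)
      finally show "1 / real n
          \<le> (\<Sum>q\<in>Q. of_bool (q dvd n) / real n + of_bool (q dvd n + 2) / real n)" .
    qed
    also have "\<dots> \<le> (\<Sum>n\<in>C. \<Sum>q\<in>Q. of_bool (q dvd n) / real n + of_bool (q dvd n + 2) / real n)"
      by (rule sum_mono2) (auto intro!: sum_nonneg finC)
    finally show ?thesis .
  qed
  also have "\<dots> = (\<Sum>q\<in>Q. (\<Sum>n | n \<in> C \<and> q dvd n. 1 / real n)
                       + (\<Sum>n | n \<in> C \<and> q dvd n + 2. 1 / real n))"
    by (subst sum.swap) (simp add: sum_filter sum.distrib)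
  also have "\<dots> \<le> (\<Sum>q\<in>Q. (7 + 4 * harm N / real M) * (1 / real q))"
  proof (rule sum_mono)
    fix q assume "q \<in> Q"
    have "(1 + harm N / M) / real q + 3 * (2 + harm N / M) / real q
        = (7 + 4 * harm N / real M) * (1 / real q)"
      by (simp add: add_divide_distrib distrib_right)
    with add_mono[OF b1[OF \<open>q \<in> Q\<close>] b2[OF \<open>q \<in> Q\<close>]]
    show "(\<Sum>n | n \<in> C \<and> q dvd n. 1 / real n) + (\<Sum>n | n \<in> C \<and> q dvd n + 2. 1 / real n)
        \<le> (7 + 4 * harm N / real M) * (1 / real q)"
      by simp
  qed
  finally show ?thesis
    by (simp add: sum_distrib_left)
qed

text \<open>The numbers \<open>j * M - 1\<close> with \<open>1 \<le> j \<le> N div M\<close> lie in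
  the progression and have reciprocals at least \<open>1 / (j * M)\<close>. Their sum is thus at
  least \<open>harm (N div M) / M\<close>, and \<open>harm k \<ge> ln (k + 1)\<close>.\<close>

lemma sum_inverse_progression_ge:
  fixes M N :: nat
  assumes "M \<ge> 2" "N > 0"
  shows "(\<Sum>n | n \<in> {1..N} \<and> M dvd n + 1. 1 / real n) \<ge> (ln N - ln M) / real M"
proof -
  let ?J = "{1..N div M}"
  have bd: "2 \<le> j * M" "j * M \<le> N" if "j \<in> ?J" for j
  proof -
    show "2 \<le> j * M"
      using that \<open>M \<ge> 2\<close> mult_le_mono[of 1 j 2 M] by simp
    show "j * M \<le> N"
      using that \<open>M \<ge> 2\<close> by (simp add: less_eq_div_iff_mult_less_eq)
  qed
  have inj: "inj_on (\<lambda>j. j * M - 1) ?J"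
  proof (rule inj_onI)
    fix i j assume "i \<in> ?J" "j \<in> ?J" "i * M - 1 = j * M - 1"
    with bd[of i] bd[of j] have "i * M = j * M"
      by linarith
    with \<open>M \<ge> 2\<close> show "i = j"
      by simp
  qed
  have "real N / real M \<le> real (N div M) + 1"
    using floor_divide_of_nat_eq[of N M, where 'a = real] by linarith
  then have "ln (real N / real M) \<le> ln (real (N div M) + 1)"
    using assms by simp
  then have "ln N - ln M \<le> ln (real (N div M) + 1)"
    using assms by (simp add: ln_div)
  also have "\<dots> \<le> harm (N div M)"
    by (rule ln_le_harm)
  finally have "(ln N - ln M) / M \<le> harm (N div M) / M"
    by (rule divide_right_mono) simp
  also have "\<dots> = (\<Sum>j\<in>?J. 1 / (real j * real M))"
    by (simp add: harm_def sum_divide_distrib field_simps)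
  also have "\<dots> \<le> (\<Sum>j\<in>?J. 1 / real (j * M - 1))"
  proof (rule sum_mono)
    fix j assume "j \<in> ?J"
    from bd(1)[OF this] obtain k where k: "j * M = Suc k" "k > 0"
      by (cases "j * M") auto
    then have "real j * real M = real (Suc k)"
      by (metis of_nat_mult)
    with k show "1 / (real j * real M) \<le> 1 / real (j * M - 1)"
      by (simp add: frac_le)
  qed
  also have "\<dots> = (\<Sum>n\<in>(\<lambda>j. j * M - 1) ` ?J. 1 / real n)"
    by (subst sum.reindex[OF inj]) simp
  also have "\<dots> \<le> (\<Sum>n | n \<in> {1..N} \<and> M dvd n + 1. 1 / real n)"
  proof (rule sum_mono2)
    show "(\<lambda>j. j * M - 1) ` ?J \<subseteq> {n. n \<in> {1..N} \<and> M dvd n + 1}"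
    proof clarify
      fix j assume "j \<in> ?J"
      from bd[OF this] show "j * M - 1 \<in> {1..N} \<and> M dvd j * M - 1 + 1"
        by (auto simp del: One_nat_def)
    qed
  qed auto
  finally show ?thesis .
qed

text \<open>The progression has logarithmic mass about \<open>ln N / M\<close>. A tail sum of at
  most 1/8 turns the sieve factor \<open>4 * harm N / M\<close> into a loss of about half of that
  mass, so \<open>c = 1 / (2 * M)\<close> survives.\<close>

lemma sum_inverse_no_divisor_ge:
  fixes Q :: "nat set"
  assumes summable: "(\<lambda>q. 1 / real q) summable_on Q" and Q: "\<And>q. q \<in> Q \<Longrightarrow> q \<ge> 2"
  obtains c K where "c > 0"
    "\<And>N. N > 0 \<Longrightarrow> (\<Sum>n | n \<in> {1..N} \<and> (\<forall>q\<in>Q. \<not> q dvd n \<and> \<not> q dvd n + 2). 1 / real n)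
            \<ge> c * ln (real N) - K"
proof -
  obtain F where F: "finite F" "F \<subseteq> Q"
    and tail: "\<And>G. finite G \<Longrightarrow> G \<subseteq> Q - F \<Longrightarrow> (\<Sum>q\<in>G. 1 / real q) \<le> 1 / 8"
    using summable_on_small_tail[OF summable, of "1 / 8"] by auto
  \<comment> \<open>The factor 2 ensures \<open>M \<ge> 2\<close> even if \<open>F\<close> is empty,
    so that \<open>M - 1\<close> is positive.\<close>
  define M where "M = 2 * \<Prod>F"
  have "\<Prod>F > 0"
    using F Q by (intro prod_pos) force
  then have M: "M \<ge> 2"
    by (simp add: M_def)
  have F_dvd: "q dvd M" if "q \<in> F" for q
    unfolding M_def using dvd_prodI[OF F(1) that, of "\<lambda>q. q"] by (rule dvd_mult)
  have *: "(\<Sum>n | n \<in> {1..N} \<and> (\<forall>q\<in>Q. \<not> q dvd n \<and> \<not> q dvd n + 2). 1 / real n)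
      \<ge> 1 / (2 * M) * ln (real N) - (ln M / M + 1 / (2 * M) + 7 / 8)" if N: "N > 0" for N
  proof -
    define C where "C = {n. n \<in> {1..N} \<and> M dvd n + 1}"
    \<comment> \<open>A finite part of \<open>Q\<close> that suffices: divisors of \<open>n\<close>
      or \<open>n + 2\<close> are at most \<open>N + 2\<close>, and for \<open>n\<close> in
      \<open>C\<close> they are coprime to \<open>M\<close>.\<close>
    define Q' where "Q' = {q \<in> Q. coprime q M \<and> q \<le> N + 2}"
    define B where "B = {n. n \<in> C \<and> (\<exists>q\<in>Q'. q dvd n \<or> q dvd n + 2)}"
    have finC: "finite C" and "B \<subseteq> C" and "finite Q'"
      by (auto simp: C_def B_def Q'_def)
    \<comment> \<open>Members of \<open>F\<close> divide \<open>M\<close>, so one coprime to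
      \<open>M\<close> would be 1, against \<open>q \<ge> 2\<close>.\<close>
    have Q'_tail: "Q' \<subseteq> Q - F"
    proof
      fix q assume "q \<in> Q'"
      then have q: "q \<in> Q" "coprime q M"
        by (auto simp: Q'_def)
      have "q \<notin> F"
      proof
        assume "q \<in> F"
        then have "q = 1"
          using F_dvd q(2) by (metis coprime_common_divisor_nat dvd_refl)
        with Q[OF q(1)] show False
          by simp
      qed
      with q show "q \<in> Q - F"
        by blast
    qed
    have "sum (\<lambda>n. 1 / real n) B \<le> (7 + 4 * harm N / real M) * (\<Sum>q\<in>Q'. 1 / real q)"
      unfolding B_def by (rule sum_inverse_sieve_le) (use M N in \<open>auto simp: C_def Q'_def\<close>)
    also have "\<dots> \<le> (7 + 4 * harm N / real M) * (1 / 8)"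
      by (intro mult_left_mono tail \<open>finite Q'\<close> Q'_tail) (simp add: harm_nonneg)
    also have "\<dots> = 7 / 8 + harm N / (2 * M)"
      using M by (simp add: field_simps)
    also have "\<dots> \<le> 7 / 8 + (1 + ln N) / (2 * M)"
      by (intro add_left_mono divide_right_mono harm_le_1_plus_ln N) simp
    finally have B: "sum (\<lambda>n. 1 / real n) B \<le> 7 / 8 + (1 + ln N) / (2 * M)" .
    have "1 / (2 * M) * ln (real N) - (ln M / M + 1 / (2 * M) + 7 / 8)
        = (ln N - ln M) / M - (7 / 8 + (1 + ln N) / (2 * M))"
      using M by (simp add: field_simps)
    also have "\<dots> \<le> sum (\<lambda>n. 1 / real n) C - sum (\<lambda>n. 1 / real n) B"
      using sum_inverse_progression_ge[OF M N] B by (simp add: C_def)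
    also have "\<dots> = sum (\<lambda>n. 1 / real n) (C - B)"
      using finC \<open>B \<subseteq> C\<close> by (simp add: sum_diff)
    also have "\<dots> \<le> (\<Sum>n | n \<in> {1..N} \<and> (\<forall>q\<in>Q. \<not> q dvd n \<and> \<not> q dvd n + 2). 1 / real n)"
    proof (rule sum_mono2)
      show "C - B \<subseteq> {n. n \<in> {1..N} \<and> (\<forall>q\<in>Q. \<not> q dvd n \<and> \<not> q dvd n + 2)}"
      proof
        fix n assume n: "n \<in> C - B"
        then have n1: "n \<in> {1..N}" "M dvd n + 1"
          by (auto simp: C_def)
        have "\<not> (q dvd n \<or> q dvd n + 2)" if "q \<in> Q" for q
        proof
          assume dvd: "q dvd n \<or> q dvd n + 2"
          then have "coprime q M"
            using coprime_if_dvd_Suc[OF n1(2)] by (metis coprime_commute coprime_divisors dvd_refl)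
          moreover have "q \<le> N + 2"
            using dvd n1(1) by (auto dest: dvd_imp_le)
          ultimately show False
            using n dvd that by (auto simp: B_def Q'_def)
        qed
        with n1 show "n \<in> {n. n \<in> {1..N} \<and> (\<forall>q\<in>Q. \<not> q dvd n \<and> \<not> q dvd n + 2)}"
          by blast
      qed
    qed auto
    finally show ?thesis .
  qed
  show ?thesis
    by (rule that[of "1 / (2 * M)", OF _ *]) (use M in auto)
qed

section \<open>Where \<open>f\<close> has absolute value 1\<close>

text \<open>Split off one prime at a time: since \<open>n\<close> is squarefree, the prime is
  coprime to the cofactor and multiplicativity applies.\<close>

lemma multiplicative_abs_eq_1:
  assumes mult: "multiplicative f" and "n > 0"
    and "\<And>p. prime p \<Longrightarrow> p dvd n \<Longrightarrow> \<bar>f p\<bar> = 1 \<and> \<not> p\<^sup>2 dvd n"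
  shows "\<bar>f n\<bar> = 1"
  using assms(2,3)
proof (induction n rule: less_induct)
  case (less n)
  show ?case
  proof (cases "n = 1")
    case True
    then show ?thesis
      using mult by (simp add: multiplicative_def)
  next
    case False
    then obtain p where p: "prime p" "p dvd n"
      using prime_factor_nat by blast
    then obtain m where n: "n = p * m"
      by blast
    have "m > 0"
      using less.prems(1) n by simp
    have "\<not> p dvd m"
      using less.prems(2)[OF p] by (auto simp: n power2_eq_square)
    then have "coprime p m"
      using p(1) by (rule prime_imp_coprime[rotated])
    have "\<bar>f m\<bar> = 1"
    proof (rule less.IH)
      show "m < n"
        using n \<open>m > 0\<close> prime_gt_1_nat[OF p(1)] by simp
      show "\<bar>f q\<bar> = 1 \<and> \<not> q\<^sup>2 dvd m" if "prime q" "q dvd m" for q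
        using less.prems(2)[of q] that by (auto simp: n)
    qed fact
    moreover have "f n = f p * f m"
      using mult \<open>coprime p m\<close> \<open>m > 0\<close> prime_gt_0_nat[OF p(1)] by (simp add: n multiplicative_def)
    ultimately show ?thesis
      using less.prems(2)[OF p] by (simp add: abs_mult)
  qed
qed

lemma summable_on_inverse_prime_squares:
  "(\<lambda>q. 1 / real q) summable_on {p\<^sup>2 | p. prime p}"
proof -
  have "summable (\<lambda>n. norm (inverse (real n ^ 2)))"
    using inverse_power_summable[of 2, where 'a = real] by simp
  then have "(\<lambda>n. inverse (real n ^ 2)) summable_on UNIV"
    by (rule norm_summable_imp_summable_on)
  then have "(\<lambda>n. inverse (real n ^ 2)) summable_on {p. prime p}"
    by (rule summable_on_subset) simp
  also have "?this \<longleftrightarrow> (\<lambda>q. 1 / real q) summable_on (\<lambda>p. p\<^sup>2) ` {p :: nat. prime p}"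
    by (subst summable_on_reindex) (auto simp: o_def inverse_eq_divide intro!: inj_onI)
  also have "(\<lambda>p. p\<^sup>2) ` {p :: nat. prime p} = {p\<^sup>2 | p. prime p}"
    by auto
  finally show ?thesis .
qed

section \<open>Pigeonhole between the two signs\<close>

theorem proposition1p5:
  fixes f :: "nat \<Rightarrow> real"
  assumes nonzero: "\<And>n. n > 0 \<Longrightarrow> f n \<noteq> 0"
    and mult: "multiplicative f"
    and conv: "(\<lambda>p. 1 / real p) summable_on {p. prime p \<and> \<bar>f p\<bar> \<noteq> 1}"
  shows "\<exists>u\<in>{-1, 1 :: real}.
           Limsup at_top (\<lambda>x :: real.
             ereal (1 / ln x * (\<Sum>n\<in>{1..nat \<lfloor>x\<rfloor>}. of_bool (f n = u * f (n + 2)) / real n))) > 0"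
proof -
  define Q where "Q = {p. prime p \<and> \<bar>f p\<bar> \<noteq> 1} \<union> {p\<^sup>2 | p. prime p}"
  define S where "S u N = (\<Sum>n\<in>{1..N}. of_bool (f n = u * f (n + 2)) / real n)" for u N
  have "(\<lambda>q. 1 / real q) summable_on Q"
    unfolding Q_def by (intro summable_on_union conv summable_on_inverse_prime_squares)
  moreover have "q \<ge> 2" if "q \<in> Q" for q
  proof -
    have "2 \<le> p\<^sup>2" if "prime p" for p :: nat
      using prime_ge_2_nat[OF that] self_le_power[of p 2] by linarith
    then show ?thesis
      using that prime_ge_2_nat by (auto simp: Q_def)
  qed
  ultimately obtain c K where c: "c > 0"
    and lower: "\<And>N. N > 0 \<Longrightarrow>
      (\<Sum>n | n \<in> {1..N} \<and> (\<forall>q\<in>Q. \<not> q dvd n \<and> \<not> q dvd n + 2). 1 / real n) \<ge> c * ln (real N) - K"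
    using sum_inverse_no_divisor_ge by blast
  have abs1: "\<bar>f n\<bar> = 1" if "n > 0" "\<forall>q\<in>Q. \<not> q dvd n" for n
    by (rule multiplicative_abs_eq_1[OF mult that(1)]) (use that(2) in \<open>auto simp: Q_def\<close>)
  \<comment> \<open>If neither \<open>n\<close> nor \<open>n + 2\<close> has a divisor in
    \<open>Q\<close>, both values are 1 or -1, so at least one of the two indicators equals
    1.\<close>
  have S_lower: "S (-1) N + S 1 N \<ge> c * ln (real N) - K" if "N > 0" for N
  proof -
    let ?G = "{n. n \<in> {1..N} \<and> (\<forall>q\<in>Q. \<not> q dvd n \<and> \<not> q dvd n + 2)}"
    let ?h = "\<lambda>n. of_bool (f n = -1 * f (n + 2)) / real n + of_bool (f n = 1 * f (n + 2)) / real n"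
    have "c * ln (real N) - K \<le> (\<Sum>n\<in>?G. 1 / real n)"
      by (rule lower[OF that])
    also have "\<dots> \<le> (\<Sum>n\<in>?G. ?h n)"
    proof (rule sum_mono)
      fix n assume "n \<in> ?G"
      then have "\<bar>f n\<bar> = 1" "\<bar>f (n + 2)\<bar> = 1"
        using abs1[of n] abs1[of "n + 2"] by auto
      then have "f n = -1 * f (n + 2) \<or> f n = 1 * f (n + 2)"
        by linarith
      then show "1 / real n \<le> ?h n"
        by auto
    qed
    also have "\<dots> \<le> (\<Sum>n\<in>{1..N}. ?h n)"
      by (rule sum_mono2) auto
    finally show ?thesis
      by (simp add: S_def sum.distrib)
  qed
  show ?thesis
  proof (rule ccontr)
    assume neg: "\<not> ?thesis"
    \<comment> \<open>With \<open>c / 4\<close> for each sign, the two sums together stay below half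
      of the main term \<open>c * ln x\<close>.\<close>
    have small: "eventually (\<lambda>x. 1 / ln x * S u (nat \<lfloor>x\<rfloor>) < c / 4) at_top"
      if "u \<in> {-1, 1}" for u
    proof -
      have "Limsup at_top (\<lambda>x :: real. ereal (1 / ln x * S u (nat \<lfloor>x\<rfloor>))) \<le> 0"
        using neg that unfolding S_def by (meson not_less)
      also have "0 < ereal (c / 4)"
        using c by simp
      finally have "eventually (\<lambda>x :: real. ereal (1 / ln x * S u (nat \<lfloor>x\<rfloor>)) < ereal (c / 4)) at_top"
        by (rule Limsup_lessD)
      then show ?thesis
        by simp
    qed
    \<comment> \<open>Beyond this threshold \<open>c * (ln x - ln 2) - K\<close> is at least
      \<open>c / 2 * ln x\<close>. The \<open>ln 2\<close> pays for rounding \<open>x\<close> down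
      to \<open>N \<ge> x / 2\<close>.\<close>
    have "eventually (\<lambda>x :: real. ln x \<ge> 2 * (c * ln 2 + K) / c) at_top"
      using ln_at_top by (simp add: filterlim_at_top)
    from eventually_conj[OF small[of "-1"] eventually_conj[OF small[of 1]
           eventually_conj[OF this eventually_ge_at_top[of 2]]]]
    obtain x :: real where x: "1 / ln x * S (-1) (nat \<lfloor>x\<rfloor>) < c / 4"
      "1 / ln x * S 1 (nat \<lfloor>x\<rfloor>) < c / 4" "ln x \<ge> 2 * (c * ln 2 + K) / c" "x \<ge> 2"
      by (auto simp: eventually_at_top_linorder)
    define N where "N = nat \<lfloor>x\<rfloor>"
    have N: "N > 0" "x / 2 \<le> real N"
      using x(4) unfolding N_def by linarith+
    have lnx: "ln x > 0"
      using x(4) by simp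
    have "ln x - ln 2 = ln (x / 2)"
      using x(4) by (simp add: ln_div)
    also have "\<dots> \<le> ln (real N)"
      using N x(4) by simp
    finally have "c * (ln x - ln 2) - K \<le> c * ln (real N) - K"
      using c by simp
    also have "\<dots> \<le> S (-1) N + S 1 N"
      by (rule S_lower[OF N(1)])
    also have "\<dots> < c / 4 * ln x + c / 4 * ln x"
      using x(1,2) lnx by (intro add_strict_mono) (simp_all add: N_def field_simps)
    finally have "c * ln x < 2 * (c * ln 2 + K)"
      by (simp add: algebra_simps)
    with x(3) c show False
      by (simp add: field_simps)
  qed
qed

end
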